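(* Let $\{d_i,i\ge1\}$ be a sequence of conditionally symmetric random vectors in $\mathbf{R}^m$ (viewed as $m\times1$ columns), adapted to an increasing sequence of $\sigma$-fields $\{\mathcal{F}_i,i\ge 0\}$. Then for any $c>0$ and any positive definite $m\times m$ matrix $V$, $$P\left\{\frac{\big(\sum_{i=1}^nd_i'\big)\big(V+\sum_{i=1}^nd_id_i'\big)^{-1}\big(\sum_{i=1}^nd_i\big)}{\log\big|V+\sum_{i=1}^nd_id_i'\big|+2\log(c/\sqrt{|V|})}\ge1\ \text{ for some }n\ge1\right\}\le c^{-1}.$$
   Context: An adapted sequence of random vectors $\{d_i\}$ in $\mathbf{R}^m$ is conditionally symmetric if for every $\lambda\in\mathbf{R}^m$ the conditional laws satisfy $\mathcal{L}(\lambda'd_i\mid\mathcal{F}_{i-1})=\mathcal{L}(-\lambda'd_i\mid\mathcal{F}_{i-1})$ for all $i$. $|\cdot|$ denotes the determinant of a square matrix and $'$ denotes transpose. Positive definite matrices are symmetric. *)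

theory Defs
  imports "HOL-Analysis.Analysis" "HOL-Probability.Probability"
begin

text \<open>The conditional law of a real random variable given a sub-sigma-algebra is given, up to
  null sets, by its values \<open>P(X \<in> B | G) = E(1\<^bsub>{X \<in> B}\<^esub> | G)\<close> on Borel sets \<open>B\<close>.\<close>

definition cond_law :: "'a measure \<Rightarrow> 'a measure \<Rightarrow> ('a \<Rightarrow> real) \<Rightarrow> real set \<Rightarrow> 'a \<Rightarrow> real" where
  "cond_law M G X B = real_cond_exp M G (indicat_real {\<omega> \<in> space M. X \<omega> \<in> B})"

definition adapted_from_1 :: "(nat \<Rightarrow> 'a measure) \<Rightarrow> (nat \<Rightarrow> 'a \<Rightarrow> real ^ 'm) \<Rightarrow> bool" where
  "adapted_from_1 F d \<longleftrightarrow> (\<forall>i\<ge>1. d i \<in> borel_measurable (F i))"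

definition conditionally_symmetric ::
    "'a measure \<Rightarrow> (nat \<Rightarrow> 'a measure) \<Rightarrow> (nat \<Rightarrow> 'a \<Rightarrow> real ^ 'm) \<Rightarrow> bool" where
  "conditionally_symmetric M F d \<longleftrightarrow>
    (\<forall>l :: real ^ 'm. \<forall>i\<ge>1. \<forall>B \<in> sets borel.
      AE \<omega> in M. cond_law M (F (i - 1)) (\<lambda>\<omega>. l \<bullet> d i \<omega>) B \<omega>
               = cond_law M (F (i - 1)) (\<lambda>\<omega>. - (l \<bullet> d i \<omega>)) B \<omega>)"

definition positive_definite :: "real ^ 'm ^ 'm \<Rightarrow> bool" where
  "positive_definite V \<longleftrightarrow> transpose V = V \<and> (\<forall>x. x \<noteq> 0 \<longrightarrow> x \<bullet> (V *v x) > 0)"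

definition outer_square :: "real ^ 'm \<Rightarrow> real ^ 'm ^ 'm" where
  "outer_square v = (columnvector v :: real ^ 1 ^ 'm) ** (rowvector v :: real ^ 'm ^ 1)"

end

theory Submission
  imports Defs
begin

text \<open>The proof mixes exponential supermartingales over a Gaussian distribution of directions.

  Write \<open>S\<^sub>n = d\<^sub>1 + \<dots> + d\<^sub>n\<close>, \<open>B\<^sub>n = d\<^sub>1 d\<^sub>1' + \<dots> + d\<^sub>n d\<^sub>n'\<close> and \<open>W\<^sub>n = V + B\<^sub>n\<close>. For a fixed
  direction \<open>x\<close>, conditional symmetry and \<open>cosh y \<le> exp (y\<^sup>2 / 2)\<close> make
  \<open>exp (x'S\<^sub>n - x'B\<^sub>n x / 2)\<close> a supermartingale, without any moment assumption
  (\<open>exp_supermartingale_step\<close>). Integrating it over \<open>x\<close> against \<open>exp (- x'V x / 2)\<close> gives a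
  nonnegative supermartingale \<open>Z\<^sub>n\<close>, and completing the square evaluates it:
  \<open>Z\<^sub>n = Z\<^sub>0 * sqrt (det V / det W\<^sub>n) * exp (S\<^sub>n' W\<^sub>n\<^sup>-\<^sup>1 S\<^sub>n / 2)\<close>. For \<open>c > 1\<close> the event in question is
  contained in the event that \<open>Z\<^sub>n \<ge> c Z\<^sub>0\<close> for some \<open>n\<close>, whose probability is at most \<open>1 / c\<close> by
  Ville's inequality (\<open>maximal_inequality\<close>). For \<open>c \<le> 1\<close> there is nothing to prove.

  The closed form of \<open>Z\<^sub>n\<close> needs how the Gaussian integral of a quadratic form depends on the form.
  Since \<open>W\<^sub>n\<close> arises from \<open>V\<close> by successive rank-one updates, it suffices to treat one update
  \<open>W + vv'\<close>: the determinant is multiplied by \<open>1 + v'W\<^sup>-\<^sup>1 v\<close> (\<open>det_add_outer_square\<close>) and the Gaussian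
  integral is divided by the square root of this number (\<open>gauss_integral_add_outer_square\<close>), because a
  rank-one perturbation of the identity carries one quadratic form to the other. The Gaussian integral
  of \<open>V\<close> itself is \<open>Z\<^sub>0\<close> and cancels, being finite and positive.

  Measure-theoretically, all statements are about nonnegative integrals over events of the past, which
  avoids conditional expectations of possibly non-integrable functions.\<close>

section \<open>Linear algebra of rank-one updates\<close>

lemma outer_square_mult_vec: "outer_square v *v x = (v \<bullet> x) *\<^sub>R v"
  by (simp add: vec_eq_iff outer_square_def matrix_matrix_mult_def matrix_vector_mult_def
      columnvector_def rowvector_def inner_vec_def sum_distrib_left sum_distrib_right ac_simps)

lemma sum_mult_vec: "(\<Sum>i\<in>I. A i) *v x = (\<Sum>i\<in>I. A i *v (x :: real ^ 'n))"
  by (induction I rule: infinite_finite_induct) (simp_all add: matrix_vector_mult_add_rdistrib)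

lemma sum_outer_square_mult_vec:
  "(\<Sum>i\<in>I. outer_square (v i)) *v x = (\<Sum>i\<in>I. (v i \<bullet> x) *\<^sub>R v i)"
  by (simp add: sum_mult_vec outer_square_mult_vec)

lemma transpose_add: "transpose (A + B) = transpose A + transpose (B :: real ^ 'n ^ 'm)"
  by (simp add: transpose_def vec_eq_iff)

lemma transpose_outer_square: "transpose (outer_square v) = outer_square v"
  by (simp add: outer_square_def matrix_transpose_mul transpose_columnvector transpose_rowvector)

lemma dot_transpose_mult: "x \<bullet> (transpose A *v y) = (A *v x) \<bullet> (y :: real ^ 'n)"
  by (metis dot_lmul_matrix inner_commute transpose_matrix_vector)

lemma positive_definite_sym:
  assumes "positive_definite W"
  shows "x \<bullet> (W *v y) = (W *v x) \<bullet> y"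
  using assms dot_transpose_mult[of x W y] by (simp add: positive_definite_def)

lemma positive_definite_nonneg: "positive_definite W \<Longrightarrow> 0 \<le> x \<bullet> (W *v x)"
  by (cases "x = 0") (auto simp: positive_definite_def intro: less_imp_le)

lemma positive_definite_add_outer_square:
  assumes "positive_definite W"
  shows "positive_definite (W + outer_square v)"
  unfolding positive_definite_def
proof (intro conjI allI impI)
  show "transpose (W + outer_square v) = W + outer_square v"
    using assms by (simp add: transpose_add transpose_outer_square positive_definite_def)
next
  fix x :: "real ^ 'a" assume "x \<noteq> 0"
  have "x \<bullet> ((W + outer_square v) *v x) = x \<bullet> (W *v x) + (v \<bullet> x)\<^sup>2"
    by (simp add: matrix_vector_mult_add_rdistrib outer_square_mult_vec inner_add_right
        power2_eq_square inner_commute)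
  moreover have "x \<bullet> (W *v x) > 0"
    using assms \<open>x \<noteq> 0\<close> by (simp add: positive_definite_def)
  ultimately show "x \<bullet> ((W + outer_square v) *v x) > 0"
    by (simp add: add_pos_nonneg)
qed

lemma positive_definite_add_sum_outer_square:
  assumes "positive_definite V"
  shows "positive_definite (V + (\<Sum>i=1..n::nat. outer_square (v i)))"
proof (induction n)
  case (Suc n)
  then show ?case
    using positive_definite_add_outer_square[OF Suc, of "v (Suc n)"] by (simp add: add.assoc)
qed (simp add: assms)

lemma positive_definite_det_nz:
  assumes "positive_definite W"
  shows "det W \<noteq> 0"
proof -
  have "inj ((*v) W)"
  proof (rule injI)
    fix x y assume "W *v x = W *v y"
    then have "(x - y) \<bullet> (W *v (x - y)) = 0"
      by (simp add: matrix_vector_mult_diff_distrib)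
    then show "x = y"
      using assms by (metis eq_iff_diff_eq_0 less_irrefl positive_definite_def)
  qed
  then show ?thesis
    by (metis invertible_det_nz invertible_left_inverse matrix_left_invertible_injective)
qed

text \<open>The segment from the identity to \<open>W\<close> stays inside the positive definite matrices, where the
  determinant cannot vanish; so it keeps the sign that it has at the identity.\<close>

lemma positive_definite_det_pos:
  assumes "positive_definite W"
  shows "det W > 0"
proof (rule ccontr)
  assume "\<not> det W > 0"
  let ?g = "\<lambda>t::real. det ((1 - t) *\<^sub>R mat 1 + t *\<^sub>R W)"
  have "continuous_on {0..1} ?g"
    unfolding det_def by (intro continuous_intros)
  moreover have "?g 1 \<le> 0" "?g 0 \<ge> 0" using \<open>\<not> det W > 0\<close> by simp_all
  ultimately obtain t where t: "0 \<le> t" "t \<le> 1" "?g t = 0"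
    using IVT2'[of ?g 1 0 0] by auto
  have "positive_definite ((1 - t) *\<^sub>R mat 1 + t *\<^sub>R W)"
    unfolding positive_definite_def
  proof (intro conjI allI impI)
    show "transpose ((1 - t) *\<^sub>R mat 1 + t *\<^sub>R W) = (1 - t) *\<^sub>R mat 1 + t *\<^sub>R W"
      using assms by (simp add: positive_definite_def transpose_add transpose_scalar)
  next
    fix x :: "real ^ 'a" assume "x \<noteq> 0"
    have "x \<bullet> (((1 - t) *\<^sub>R mat 1 + t *\<^sub>R W) *v x) = (1 - t) * (x \<bullet> x) + t * (x \<bullet> (W *v x))"
      by (simp add: matrix_vector_mult_add_rdistrib inner_add_right scaleR_matrix_vector_assoc[symmetric])
    moreover have "x \<bullet> x > 0" "x \<bullet> (W *v x) > 0"
      using \<open>x \<noteq> 0\<close> assms by (simp_all add: positive_definite_def)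
    ultimately show "x \<bullet> (((1 - t) *\<^sub>R mat 1 + t *\<^sub>R W) *v x) > 0"
      using t by (cases "t = 1") (simp_all add: add_pos_nonneg)
  qed
  then show False using positive_definite_det_nz t(3) by blast
qed

lemma positive_definite_mult_matrix_inv:
  assumes "positive_definite W"
  shows "W *v (matrix_inv W *v s) = s"
proof -
  have "\<exists>A. W ** A = mat 1 \<and> A ** W = mat 1"
    using positive_definite_det_nz[OF assms] by (metis invertible_det_nz invertible_def)
  then have "W ** matrix_inv W = mat 1"
    unfolding matrix_inv_def by (rule someI2_ex) simp
  then show ?thesis by (simp add: matrix_vector_mul_assoc)
qed

text \<open>An orthogonal change of basis turns \<open>v\<close> into a multiple of a basis vector, and then only one
  column of the identity matrix is perturbed; Cramer's rule evaluates that determinant.\<close>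

lemma det_id_plus_rank_one:
  fixes u v :: "real ^ 'n"
  assumes "\<And>x. A *v x = x + (v \<bullet> x) *\<^sub>R u"
  shows "det A = 1 + v \<bullet> u"
proof -
  have col: "det B = 1 + w $ k"
    if B: "\<And>x. B *v x = x + (x $ k) *\<^sub>R w" for B :: "real ^ 'n ^ 'n" and w k
  proof -
    have "B = (\<chi> i j. if j = k then (mat 1 *v (axis k 1 + w)) $ i else mat 1 $ i $ j)"
    proof -
      have "B $ i $ j = (axis j 1 + (axis j 1 $ k) *\<^sub>R w) $ i" for i j
        using B[of "axis j 1"] by (simp add: matrix_vector_mult_basis vec_eq_iff column_def)
      then show ?thesis
        by (simp only: matrix_vector_mul_lid) (simp add: vec_eq_iff mat_def axis_def)
    qed
    then show ?thesis
      using cramer_lemma[where A = "mat 1 :: real ^ 'n ^ 'n" and k = k and x = "axis k 1 + w"] by simp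
  qed
  show ?thesis
  proof (cases "v = 0")
    case True
    then have "A = mat 1" using assms by (simp add: matrix_eq)
    then show ?thesis using True by simp
  next
    case False
    obtain k :: 'n where True by simp
    obtain Q where Q: "orthogonal_matrix Q" "Q *v axis k 1 = (1 / norm v) *\<^sub>R v"
      using orthogonal_matrix_exists_basis[of "(1 / norm v) *\<^sub>R v" k] False by auto
    have QQ: "transpose Q ** Q = mat 1" "Q ** transpose Q = mat 1"
      using Q(1) by (auto simp: orthogonal_matrix_def)
    have v: "v = norm v *\<^sub>R (Q *v axis k 1)" using Q(2) False by simp
    have vQ: "v \<bullet> (Q *v x) = norm v * x $ k" for x
    proof -
      have "(Q *v axis k 1) \<bullet> (Q *v x) = axis k 1 \<bullet> (transpose Q *v (Q *v x))"
        by (rule dot_transpose_mult[symmetric])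
      also have "\<dots> = x $ k"
        by (simp only: matrix_vector_mul_assoc QQ matrix_vector_mul_lid) (simp add: inner_axis')
      finally show ?thesis by (subst v) simp
    qed
    define w where "w = norm v *\<^sub>R (transpose Q *v u)"
    have "(transpose Q ** A ** Q) *v x = x + (x $ k) *\<^sub>R w" for x
    proof -
      have "(transpose Q ** A ** Q) *v x = (transpose Q ** Q) *v x + (norm v * x $ k) *\<^sub>R (transpose Q *v u)"
        by (simp only: matrix_vector_mul_assoc[symmetric] assms vQ matrix_vector_right_distrib matrix_vector_mult_scaleR)
      then show ?thesis by (simp add: QQ w_def mult.commute)
    qed
    then have "det (transpose Q ** A ** Q) = 1 + w $ k" by (rule col)
    moreover have "det (transpose Q ** A ** Q) = det (transpose Q ** Q) * det A"
      by (simp add: det_mul)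
    moreover have "w $ k = v \<bullet> u"
    proof -
      have "w $ k = norm v * (transpose Q *v u) $ k" by (simp add: w_def)
      also have "\<dots> = v \<bullet> (Q *v (transpose Q *v u))" by (rule vQ[symmetric])
      also have "\<dots> = v \<bullet> u" by (simp only: matrix_vector_mul_assoc QQ matrix_vector_mul_lid)
      finally show ?thesis .
    qed
    ultimately show ?thesis by (simp add: QQ)
  qed
qed

text \<open>The update is multiplicative: \<open>W + vv' = W (I + W\<^sup>-\<^sup>1 v v')\<close>.\<close>

lemma det_add_outer_square:
  assumes "positive_definite W"
  shows "det (W + outer_square v) = det W * (1 + v \<bullet> (matrix_inv W *v v))"
proof -
  define f where "f x = x + (v \<bullet> x) *\<^sub>R (matrix_inv W *v v)" for x
  have "linear f"
    by (rule linearI) (simp_all add: f_def inner_add_right algebra_simps)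
  then have f: "matrix f *v x = x + (v \<bullet> x) *\<^sub>R (matrix_inv W *v v)" for x
    by (simp add: matrix_works f_def)
  have "W + outer_square v = W ** matrix f"
    using positive_definite_mult_matrix_inv[OF assms]
    by (simp add: matrix_eq matrix_vector_mul_assoc[symmetric] f matrix_vector_right_distrib
        matrix_vector_mult_scaleR matrix_vector_mult_add_rdistrib outer_square_mult_vec)
  then show ?thesis using det_id_plus_rank_one[OF f] by (simp add: det_mul)
qed

lemma positive_definite_inv_nonneg:
  assumes "positive_definite W"
  shows "0 \<le> v \<bullet> (matrix_inv W *v v)"
  using positive_definite_nonneg[OF assms, of "matrix_inv W *v v"]
  by (simp add: positive_definite_mult_matrix_inv[OF assms] inner_commute)

lemma det_le_det_add_sum_outer_square:
  assumes "positive_definite V"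
  shows "det V \<le> det (V + (\<Sum>i=1..n::nat. outer_square (v i)))"
proof (induction n)
  case (Suc n)
  let ?W = "V + (\<Sum>i=1..n. outer_square (v i))"
  have W: "positive_definite ?W" by (rule positive_definite_add_sum_outer_square[OF assms])
  have "det ?W * 1 \<le> det ?W * (1 + v (Suc n) \<bullet> (matrix_inv ?W *v v (Suc n)))"
    using positive_definite_det_pos[OF W] positive_definite_inv_nonneg[OF W]
    by (intro mult_left_mono) auto
  also have "\<dots> = det (?W + outer_square (v (Suc n)))"
    by (rule det_add_outer_square[OF W, symmetric])
  finally show ?case using Suc by (simp add: add.assoc)
qed simp

section \<open>Gaussian integrals\<close>

lemma nn_integral_translation:
  fixes f :: "'n::euclidean_space \<Rightarrow> ennreal"
  assumes "f \<in> borel_measurable borel"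
  shows "(\<integral>\<^sup>+x. f (c + x) \<partial>lborel) = (\<integral>\<^sup>+x. f x \<partial>lborel)"
proof -
  have "(\<integral>\<^sup>+x. f x \<partial>lborel) = (\<integral>\<^sup>+x. f x \<partial>distr lborel borel ((+) c))"
    by (simp add: lborel_distr_plus)
  also have "\<dots> = (\<integral>\<^sup>+x. f (c + x) \<partial>lborel)"
    using assms by (simp add: nn_integral_distr)
  finally show ?thesis by simp
qed

text \<open>Averaging over the translations \<open>t u\<close>, \<open>0 \<le> t \<le> 1\<close>, reduces the change of variables
  \<open>x \<mapsto> x + (v'x) u\<close> to Tonelli's theorem, translation invariance and an affine substitution
  on the real line.\<close>

lemma nn_integral_rank_one:
  fixes u v :: "'n::euclidean_space" and f :: "'n \<Rightarrow> ennreal"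
  assumes k: "1 + v \<bullet> u \<noteq> 0" and f[measurable]: "f \<in> borel_measurable borel"
  shows "ennreal \<bar>1 + v \<bullet> u\<bar> * (\<integral>\<^sup>+x. f (x + (v \<bullet> x) *\<^sub>R u) \<partial>lborel) = (\<integral>\<^sup>+x. f x \<partial>lborel)"
proof -
  define k where "k = 1 + v \<bullet> u"
  have "k \<noteq> 0" using assms by (simp add: k_def)
  define b :: "real \<Rightarrow> ennreal" where "b = indicator {0..1}"
  have b[measurable]: "b \<in> borel_measurable borel" by (simp add: b_def)
  have b1: "(\<integral>\<^sup>+t. b (t - c) \<partial>lborel) = 1" for c
    using nn_integral_translation[of "\<lambda>t. b (t - c)" c] by (simp add: b_def)
  have "(\<integral>\<^sup>+x. f (x + (v \<bullet> x) *\<^sub>R u) \<partial>lborel)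
      = (\<integral>\<^sup>+t. b t * (\<integral>\<^sup>+x. f (x + (v \<bullet> x) *\<^sub>R u) \<partial>lborel) \<partial>lborel)"
    using b1[of 0] by (simp add: nn_integral_multc)
  also have "\<dots> = (\<integral>\<^sup>+t. b t * (\<integral>\<^sup>+x. f (x + (k * t + v \<bullet> x) *\<^sub>R u) \<partial>lborel) \<partial>lborel)"
  proof -
    have "(\<integral>\<^sup>+x. f (x + (v \<bullet> x) *\<^sub>R u) \<partial>lborel)
        = (\<integral>\<^sup>+x. f ((t *\<^sub>R u + x) + (v \<bullet> (t *\<^sub>R u + x)) *\<^sub>R u) \<partial>lborel)" for t
      by (rule nn_integral_translation[symmetric]) measurable
    moreover have "(t *\<^sub>R u + x) + (v \<bullet> (t *\<^sub>R u + x)) *\<^sub>R u = x + (k * t + v \<bullet> x) *\<^sub>R u" for t x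
      by (simp add: k_def inner_add_right algebra_simps)
    ultimately show ?thesis by simp
  qed
  also have "\<dots> = (\<integral>\<^sup>+t. (\<integral>\<^sup>+x. b t * f (x + (k * t + v \<bullet> x) *\<^sub>R u) \<partial>lborel) \<partial>lborel)"
    by (simp add: nn_integral_cmult)
  also have "\<dots> = (\<integral>\<^sup>+x. (\<integral>\<^sup>+t. b t * f (x + (k * t + v \<bullet> x) *\<^sub>R u) \<partial>lborel) \<partial>lborel)"
    by (rule lborel_pair.Fubini') measurable
  finally have "ennreal \<bar>k\<bar> * (\<integral>\<^sup>+x. f (x + (v \<bullet> x) *\<^sub>R u) \<partial>lborel)
      = (\<integral>\<^sup>+x. ennreal \<bar>k\<bar> * (\<integral>\<^sup>+t. b t * f (x + (k * t + v \<bullet> x) *\<^sub>R u) \<partial>lborel) \<partial>lborel)"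
    by (simp add: nn_integral_cmult)
  also have "\<dots> = (\<integral>\<^sup>+x. (\<integral>\<^sup>+s. b ((s - v \<bullet> x) / k) * f (x + s *\<^sub>R u) \<partial>lborel) \<partial>lborel)"
  proof (rule nn_integral_cong)
    fix x
    have "(\<integral>\<^sup>+s. b ((s - v \<bullet> x) / k) * f (x + s *\<^sub>R u) \<partial>lborel)
        = ennreal \<bar>k\<bar> * (\<integral>\<^sup>+t. b (((v \<bullet> x + k * t) - v \<bullet> x) / k) * f (x + (v \<bullet> x + k * t) *\<^sub>R u) \<partial>lborel)"
      by (rule nn_integral_real_affine) (use \<open>k \<noteq> 0\<close> in measurable)
    then show "ennreal \<bar>k\<bar> * (\<integral>\<^sup>+t. b t * f (x + (k * t + v \<bullet> x) *\<^sub>R u) \<partial>lborel)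
        = (\<integral>\<^sup>+s. b ((s - v \<bullet> x) / k) * f (x + s *\<^sub>R u) \<partial>lborel)"
      using \<open>k \<noteq> 0\<close> by (simp add: add.commute)
  qed
  also have "\<dots> = (\<integral>\<^sup>+s. (\<integral>\<^sup>+x. b ((s - v \<bullet> x) / k) * f (x + s *\<^sub>R u) \<partial>lborel) \<partial>lborel)"
    by (rule lborel_pair.Fubini'[symmetric]) measurable
  also have "\<dots> = (\<integral>\<^sup>+s. (\<integral>\<^sup>+x. b (s - v \<bullet> x / k) * f x \<partial>lborel) \<partial>lborel)"
  proof (rule nn_integral_cong)
    fix s :: real
    have "(\<integral>\<^sup>+x. b (s - v \<bullet> x / k) * f x \<partial>lborel)
        = (\<integral>\<^sup>+x. b (s - v \<bullet> (s *\<^sub>R u + x) / k) * f (s *\<^sub>R u + x) \<partial>lborel)"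
      by (rule nn_integral_translation[symmetric]) measurable
    moreover have "s - v \<bullet> (s *\<^sub>R u + x) / k = (s - v \<bullet> x) / k" for x
    proof -
      have "s - v \<bullet> (s *\<^sub>R u + x) / k = (s * k - (s * (v \<bullet> u) + v \<bullet> x)) / k"
        using \<open>k \<noteq> 0\<close> by (simp add: inner_add_right diff_divide_distrib)
      also have "s * k - (s * (v \<bullet> u) + v \<bullet> x) = s - v \<bullet> x" by (simp add: k_def algebra_simps)
      finally show ?thesis .
    qed
    ultimately show "(\<integral>\<^sup>+x. b ((s - v \<bullet> x) / k) * f (x + s *\<^sub>R u) \<partial>lborel)
        = (\<integral>\<^sup>+x. b (s - v \<bullet> x / k) * f x \<partial>lborel)" by (simp add: add.commute)
  qed
  also have "\<dots> = (\<integral>\<^sup>+x. (\<integral>\<^sup>+s. b (s - v \<bullet> x / k) * f x \<partial>lborel) \<partial>lborel)"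
    by (rule lborel_pair.Fubini') measurable
  also have "\<dots> = (\<integral>\<^sup>+x. f x \<partial>lborel)"
    by (simp add: nn_integral_multc b1)
  finally show ?thesis by (simp add: k_def)
qed

definition gauss_integral :: "real ^ 'n ^ 'n \<Rightarrow> ennreal" where
  "gauss_integral W = (\<integral>\<^sup>+x. ennreal (exp (- (x \<bullet> (W *v x)) / 2)) \<partial>lborel)"

lemma borel_measurable_mult_vec [measurable]:
  "(\<lambda>x. W *v x) \<in> borel_measurable (borel :: (real ^ 'n) measure)" for W :: "real ^ 'n ^ 'm"
  by (intro borel_measurable_continuous_onI matrix_vector_mult_linear_continuous_on)

lemma positive_definite_lower_bound:
  assumes "positive_definite W"
  obtains e where "e > 0" "\<And>x. e * (x \<bullet> x) \<le> x \<bullet> (W *v x)"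
proof -
  have "continuous_on (sphere 0 1) (\<lambda>x. x \<bullet> (W *v x))"
    by (intro continuous_intros matrix_vector_mult_linear_continuous_on)
  moreover have "sphere (0 :: real ^ 'a) 1 \<noteq> {}" by simp
  ultimately obtain y where y: "norm y = 1" "\<And>x. norm x = 1 \<Longrightarrow> y \<bullet> (W *v y) \<le> x \<bullet> (W *v x)"
    using continuous_attains_inf[of "sphere 0 1" "\<lambda>x. x \<bullet> (W *v x)"] by auto
  have "y \<noteq> 0" using y(1) by auto
  then have "y \<bullet> (W *v y) > 0" using assms by (simp add: positive_definite_def)
  moreover have "y \<bullet> (W *v y) * (x \<bullet> x) \<le> x \<bullet> (W *v x)" for x
  proof (cases "x = 0")
    case False
    let ?z = "(1 / norm x) *\<^sub>R x"
    have "y \<bullet> (W *v y) \<le> ?z \<bullet> (W *v ?z)" using False by (intro y(2)) simp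
    also have "\<dots> = x \<bullet> (W *v x) / (norm x)\<^sup>2"
      by (simp add: matrix_vector_mult_scaleR power2_eq_square)
    finally show ?thesis using False by (simp add: field_simps power2_norm_eq_inner[symmetric])
  qed simp
  ultimately show ?thesis by (rule that)
qed

text \<open>The quadratic form dominates a multiple of the squared norm, whose Gaussian integral factors
  over the coordinates.\<close>

lemma gauss_integral_finite:
  fixes W :: "real ^ 'n ^ 'n"
  assumes "positive_definite W"
  shows "gauss_integral W < \<infinity>"
proof -
  obtain e where e: "e > 0" "\<And>x. e * (x \<bullet> x) \<le> x \<bullet> (W *v x)"
    using positive_definite_lower_bound[OF assms] by blast
  have one: "(\<integral>\<^sup>+t. ennreal (exp (- (e * t\<^sup>2) / 2)) \<partial>lborel) < \<infinity>"
  proof -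
    have s: "sqrt (1 / e) > 0" using e by simp
    have "exp (- (e * t\<^sup>2) / 2) = sqrt (2 * pi / e) * normal_density 0 (sqrt (1 / e)) t" for t
      using e by (simp add: normal_density_def real_sqrt_divide real_sqrt_mult field_simps)
    moreover have "integrable lborel (normal_density 0 (sqrt (1 / e)))"
      using s by simp
    ultimately have "integrable lborel (\<lambda>t. exp (- (e * t\<^sup>2) / 2))" by simp
    then show ?thesis by (simp add: integrable_iff_bounded)
  qed
  have "gauss_integral W \<le> (\<integral>\<^sup>+x. (\<Prod>b\<in>Basis. exp (- (e * (x \<bullet> b)\<^sup>2) / 2)) \<partial>(lborel :: (real ^ 'n) measure))"
    unfolding gauss_integral_def
  proof (intro nn_integral_mono ennreal_leI)
    fix x :: "real ^ 'n"
    have "(\<Prod>b\<in>Basis. exp (- (e * (x \<bullet> b)\<^sup>2) / 2)) = exp (- (e * (\<Sum>b\<in>Basis. (x \<bullet> b)\<^sup>2)) / 2)"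
      by (simp add: exp_sum[symmetric] sum_distrib_left sum_negf sum_divide_distrib)
    also have "(\<Sum>b\<in>Basis. (x \<bullet> b)\<^sup>2) = x \<bullet> x"
      by (simp add: euclidean_inner[of x x] power2_eq_square)
    finally show "exp (- (x \<bullet> (W *v x)) / 2) \<le> (\<Prod>b\<in>Basis. exp (- (e * (x \<bullet> b)\<^sup>2) / 2))"
      using e(2)[of x] by simp
  qed
  also have "\<dots> = (\<Prod>b\<in>(Basis :: (real ^ 'n) set). \<integral>\<^sup>+t. exp (- (e * t\<^sup>2) / 2) \<partial>lborel)"
    by (subst nn_integral_lborel_prod[symmetric]) (auto simp: prod_ennreal)
  also have "\<dots> < \<infinity>" using one by (simp add: power_less_top_ennreal)
  finally show ?thesis .
qed

lemma gauss_integral_pos: "gauss_integral W > 0"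
proof -
  have "gauss_integral W \<noteq> 0"
  proof
    assume "gauss_integral W = 0"
    then have "AE x in lborel. ennreal (exp (- (x \<bullet> (W *v x)) / 2)) = 0"
      unfolding gauss_integral_def by (subst (asm) nn_integral_0_iff_AE) auto
    then have "AE x in (lborel :: (real ^ 'a) measure). False" by (simp add: ennreal_eq_0_iff)
    then show False by (simp add: AE_iff_null emeasure_lborel_UNIV null_sets_def)
  qed
  then show ?thesis by (simp add: zero_less_iff_neq_zero)
qed

text \<open>With \<open>u = W\<^sup>-\<^sup>1 v\<close> and \<open>q = v'W\<^sup>-\<^sup>1 v\<close>, the map \<open>T x = x + \<alpha> (v'x) u\<close> satisfies
  \<open>T'WT = W + (2 \<alpha> + \<alpha>\<^sup>2 q) vv'\<close> and \<open>det T = 1 + \<alpha> q\<close>. The choice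
  \<open>\<alpha> = 1 / (1 + sqrt (1 + q))\<close> solves \<open>2 \<alpha> + \<alpha>\<^sup>2 q = 1\<close> and gives \<open>det T = sqrt (1 + q)\<close>.\<close>

lemma gauss_integral_add_outer_square:
  fixes W :: "real ^ 'n ^ 'n"
  assumes "positive_definite W"
  shows "ennreal (sqrt (1 + v \<bullet> (matrix_inv W *v v))) * gauss_integral (W + outer_square v)
    = gauss_integral W"
proof -
  define u where "u = matrix_inv W *v v"
  have Wu: "W *v u = v"
    using assms unfolding u_def by (rule positive_definite_mult_matrix_inv)
  define q where "q = v \<bullet> u"
  have "q \<ge> 0" using positive_definite_inv_nonneg[OF assms] by (simp add: q_def u_def)
  define r where "r = sqrt (1 + q)"
  have r: "q = r\<^sup>2 - 1" "r \<ge> 1" using \<open>q \<ge> 0\<close> by (auto simp: r_def)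
  define a where "a = 1 / (1 + r)"
  have "a * (1 + r) = 1" using r by (simp add: a_def)
  then have aq: "1 + a * q = r" unfolding r(1) by algebra
  have "2 * a + a\<^sup>2 * q = a * (1 + (1 + a * q))" by (simp add: algebra_simps power2_eq_square)
  then have a: "2 * a + a\<^sup>2 * q = 1" using aq \<open>a * (1 + r) = 1\<close> by simp
  define f where "f x = x + ((a *\<^sub>R v) \<bullet> x) *\<^sub>R u" for x
  have quad: "f x \<bullet> (W *v f x) = x \<bullet> ((W + outer_square v) *v x)" for x
  proof -
    have "u \<bullet> (W *v x) = v \<bullet> x" using positive_definite_sym[OF assms, of u x] by (simp add: Wu)
    then have "f x \<bullet> (W *v f x) = x \<bullet> (W *v x) + (2 * a + a\<^sup>2 * q) * (v \<bullet> x)\<^sup>2"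
      by (simp add: f_def matrix_vector_right_distrib matrix_vector_mult_scaleR inner_add_left
          inner_add_right Wu q_def inner_commute algebra_simps power2_eq_square)
    then show ?thesis unfolding a
      by (simp add: matrix_vector_mult_add_rdistrib outer_square_mult_vec inner_add_right
        power2_eq_square inner_commute)
  qed
  have k: "1 + (a *\<^sub>R v) \<bullet> u = r" using aq by (simp add: q_def)
  have "ennreal r * (\<integral>\<^sup>+x. ennreal (exp (- (f x \<bullet> (W *v f x)) / 2)) \<partial>lborel) = gauss_integral W"
    unfolding f_def gauss_integral_def
    using nn_integral_rank_one[of "a *\<^sub>R v" u "\<lambda>x. ennreal (exp (- (x \<bullet> (W *v x)) / 2))"] r(2)
    unfolding k by simp
  then show ?thesis unfolding quad by (simp add: gauss_integral_def r_def q_def u_def)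
qed

text \<open>The Gaussian integral is inversely proportional to the square root of the determinant. Only the
  ratio of two such integrals is used, so the constant \<open>(2 \<pi>)\<^bsup>m/2\<^esup>\<close> never appears.\<close>

lemma gauss_integral_add_sum_outer_square:
  fixes V :: "real ^ 'n ^ 'n" and v :: "nat \<Rightarrow> real ^ 'n"
  assumes V: "positive_definite V"
  defines "W \<equiv> \<lambda>n::nat. V + (\<Sum>i=1..n. outer_square (v i))"
  shows "gauss_integral (W n) = ennreal (sqrt (det V / det (W n))) * gauss_integral V"
proof (induction n)
  case 0
  show ?case using positive_definite_det_pos[OF V] by (simp add: W_def)
next
  case (Suc n)
  have W: "positive_definite (W n)" for n
    unfolding W_def by (rule positive_definite_add_sum_outer_square[OF V])
  define p where "p = 1 + v (Suc n) \<bullet> (matrix_inv (W n) *v v (Suc n))"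
  have "p > 0" using positive_definite_inv_nonneg[OF W[of n]] by (simp add: p_def add_pos_nonneg)
  have WS: "W (Suc n) = W n + outer_square (v (Suc n))" by (simp add: W_def add.assoc)
  have det: "det (W (Suc n)) = det (W n) * p"
    unfolding WS p_def by (rule det_add_outer_square[OF W])
  have "gauss_integral (W (Suc n)) = ennreal (1 / sqrt p) * (ennreal (sqrt p) * gauss_integral (W (Suc n)))"
    using \<open>p > 0\<close> by (simp add: mult.assoc[symmetric] ennreal_mult[symmetric])
  also have "ennreal (sqrt p) * gauss_integral (W (Suc n)) = gauss_integral (W n)"
    unfolding WS p_def by (rule gauss_integral_add_outer_square[OF W])
  also have "\<dots> = ennreal (sqrt (det V / det (W n))) * gauss_integral V" by (rule Suc)
  also have "ennreal (1 / sqrt p) * (ennreal (sqrt (det V / det (W n))) * gauss_integral V)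
      = ennreal (sqrt (det V / det (W (Suc n)))) * gauss_integral V"
  proof -
    have "sqrt (det V / det (W (Suc n))) = 1 / sqrt p * sqrt (det V / det (W n))"
      by (simp add: det real_sqrt_divide real_sqrt_mult)
    moreover have "ennreal (1 / sqrt p * sqrt (det V / det (W n)))
        = ennreal (1 / sqrt p) * ennreal (sqrt (det V / det (W n)))"
      using \<open>p > 0\<close> positive_definite_det_pos[OF V] positive_definite_det_pos[OF W[of n]]
      by (intro ennreal_mult) simp_all
    ultimately show ?thesis by (simp only: mult.assoc)
  qed
  finally show ?case .
qed

text \<open>Completing the square about \<open>W\<^sup>-\<^sup>1 s\<close>.\<close>

lemma gauss_integral_tilted:
  fixes W :: "real ^ 'n ^ 'n"
  assumes W: "positive_definite W"
  shows "(\<integral>\<^sup>+x. ennreal (exp (x \<bullet> s - x \<bullet> (W *v x) / 2)) \<partial>lborel)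
      = ennreal (exp (s \<bullet> (matrix_inv W *v s) / 2)) * gauss_integral W"
proof -
  define m where "m = matrix_inv W *v s"
  have Wm: "W *v m = s" unfolding m_def by (rule positive_definite_mult_matrix_inv[OF W])
  have quad: "(m + x) \<bullet> s - (m + x) \<bullet> (W *v (m + x)) / 2 = s \<bullet> m / 2 - x \<bullet> (W *v x) / 2" for x
  proof -
    have "m \<bullet> (W *v x) = s \<bullet> x" using positive_definite_sym[OF W, of m x] by (simp add: Wm)
    then show ?thesis
      by (simp add: matrix_vector_right_distrib inner_add_left inner_add_right Wm inner_commute field_simps)
  qed
  have "(\<integral>\<^sup>+x. ennreal (exp (x \<bullet> s - x \<bullet> (W *v x) / 2)) \<partial>lborel)
      = (\<integral>\<^sup>+x. ennreal (exp ((m + x) \<bullet> s - (m + x) \<bullet> (W *v (m + x)) / 2)) \<partial>lborel)"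
    by (rule nn_integral_translation[symmetric]) measurable
  also have "\<dots> = (\<integral>\<^sup>+x. ennreal (exp (s \<bullet> m / 2)) * ennreal (exp (- (x \<bullet> (W *v x)) / 2)) \<partial>lborel)"
    unfolding quad by (intro nn_integral_cong) (simp add: ennreal_mult[symmetric] exp_add[symmetric])
  also have "\<dots> = ennreal (exp (s \<bullet> m / 2)) * (\<integral>\<^sup>+x. ennreal (exp (- (x \<bullet> (W *v x)) / 2)) \<partial>lborel)"
    by (rule nn_integral_cmult) measurable
  finally show ?thesis unfolding m_def gauss_integral_def .
qed

section \<open>Symmetry and supermartingales\<close>

lemma cosh_le_exp_half_square: "cosh x \<le> exp (x\<^sup>2 / 2)" for x :: real
proof -
  have pos: "cosh x \<le> exp (x\<^sup>2 / 2)" if "x \<ge> 0" for x :: real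
  proof -
    have tanh_le: "tanh t \<le> t" if "t \<ge> 0" for t :: real
    proof -
      have "0 - tanh 0 \<le> t - tanh t"
      proof (rule DERIV_nonneg_imp_nondecreasing[OF that])
        fix s :: real
        have "((\<lambda>t. t - tanh t) has_real_derivative 1 - (1 - tanh s ^ 2)) (at s)"
          by (auto intro!: derivative_eq_intros)
        then show "\<exists>y. ((\<lambda>t. t - tanh t) has_real_derivative y) (at s) \<and> 0 \<le> y"
          by (intro exI[of _ "1 - (1 - tanh s ^ 2)"]) simp
      qed
      then show ?thesis by simp
    qed
    have "0\<^sup>2 / 2 - ln (cosh 0) \<le> x\<^sup>2 / 2 - ln (cosh x)"
    proof (rule DERIV_nonneg_imp_nondecreasing[OF that])
      fix s :: real assume "0 \<le> s"
      have "((\<lambda>x. x\<^sup>2 / 2 - ln (cosh x)) has_real_derivative s - tanh s) (at s)"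
        by (auto intro!: derivative_eq_intros simp: tanh_def field_simps)
      then show "\<exists>y. ((\<lambda>x. x\<^sup>2 / 2 - ln (cosh x)) has_real_derivative y) (at s) \<and> 0 \<le> y"
        using tanh_le[OF \<open>0 \<le> s\<close>] by (intro exI[of _ "s - tanh s"]) simp
    qed
    then have "ln (cosh x) \<le> x\<^sup>2 / 2" by simp
    then show ?thesis by (metis cosh_real_pos exp_le_cancel_iff exp_ln)
  qed
  show ?thesis using pos[of x] pos[of "- x"] by (cases "x \<ge> 0") auto
qed

text \<open>Everything that is needed from conditional symmetry: a weight \<open>Y\<close> known at the earlier time
  does not distinguish \<open>X\<close> from \<open>- X\<close>. The hypothesis gives this when \<open>Y\<close> and \<open>h\<close> are both
  indicators. For a fixed event \<open>{X \<in> B}\<close> the two sides are integrals of \<open>Y\<close> against measures on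
  \<open>G\<close>, which therefore agree; for a fixed \<open>Y\<close> they are integrals of \<open>h\<close> against the laws of \<open>X\<close>
  and \<open>- X\<close> weighted by \<open>Y\<close>, which then agree as well.\<close>

lemma (in prob_space) nn_integral_symmetric:
  fixes X :: "'a \<Rightarrow> real"
  assumes sub: "subalgebra M G" and X[measurable]: "X \<in> borel_measurable M"
    and sym: "\<And>B. B \<in> sets borel \<Longrightarrow>
      AE \<omega> in M. cond_law M G X B \<omega> = cond_law M G (\<lambda>\<omega>. - X \<omega>) B \<omega>"
    and Y: "Y \<in> borel_measurable G" and h[measurable]: "h \<in> borel_measurable borel"
  shows "(\<integral>\<^sup>+\<omega>. Y \<omega> * h (X \<omega>) \<partial>M) = (\<integral>\<^sup>+\<omega>. Y \<omega> * h (- X \<omega>) \<partial>M)"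
proof -
  have fin: "finite_measure_subalgebra M G"
    by (simp add: finite_measure_subalgebra_def finite_measure_subalgebra_axioms_def sub finite_measure_axioms)
  interpret finite_measure_subalgebra M G by (rule fin)
  have YM[measurable]: "Y \<in> borel_measurable M"
    using Y sub by (metis measurable_from_subalg)
  have ev: "{\<omega> \<in> space M. Z \<omega> \<in> B} \<in> sets M" if "Z \<in> borel_measurable M" "B \<in> sets borel"
    for Z :: "'a \<Rightarrow> real" and B
    using that by measurable
  \<comment> \<open>Indicator weight and indicator function: integrate the conditional laws over \<open>A\<close>.\<close>
  have real_event: "measure M (A \<inter> {\<omega> \<in> space M. X \<omega> \<in> B}) = measure M (A \<inter> {\<omega> \<in> space M. - X \<omega> \<in> B})"
    if A: "A \<in> sets G" and B: "B \<in> sets borel" for A B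
  proof -
    have AM: "A \<in> sets M" using A sub by (auto simp: subalgebra_def)
    have law: "measure M (A \<inter> {\<omega> \<in> space M. Z \<omega> \<in> B}) = (\<integral>\<omega>\<in>A. cond_law M G Z B \<omega> \<partial>M)"
      if Z: "Z \<in> borel_measurable M" for Z :: "'a \<Rightarrow> real"
    proof -
      have E: "{\<omega> \<in> space M. Z \<omega> \<in> B} \<in> sets M" using Z B by (rule ev)
      have "(\<integral>\<omega>\<in>A. cond_law M G Z B \<omega> \<partial>M) = (\<integral>\<omega>\<in>A. indicat_real {\<omega> \<in> space M. Z \<omega> \<in> B} \<omega> \<partial>M)"
        unfolding cond_law_def using E A
        by (intro real_cond_exp_intA[symmetric]) (auto simp: emeasure_eq_measure)
      also have "\<dots> = measure M (A \<inter> {\<omega> \<in> space M. Z \<omega> \<in> B})"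
        using E AM by (simp add: set_lebesgue_integral_def indicator_inter_arith[symmetric] sets.Int_space_eq1 Int_absorb1 sets.Int_space_eq2)
      finally show ?thesis by simp
    qed
    have "(\<integral>\<omega>\<in>A. cond_law M G X B \<omega> \<partial>M) = (\<integral>\<omega>\<in>A. cond_law M G (\<lambda>\<omega>. - X \<omega>) B \<omega> \<partial>M)"
      unfolding set_lebesgue_integral_def
    proof (rule integral_cong_AE)
      show "AE \<omega> in M. indicat_real A \<omega> *\<^sub>R cond_law M G X B \<omega>
          = indicat_real A \<omega> *\<^sub>R cond_law M G (\<lambda>\<omega>. - X \<omega>) B \<omega>"
        using sym[OF B] by eventually_elim simp
    qed (use AM in \<open>simp_all add: cond_law_def\<close>)
    then show ?thesis using law[OF X] law[of "\<lambda>\<omega>. - X \<omega>"] by simp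
  qed
  \<comment> \<open>General weight, indicator function.\<close>
  have event: "(\<integral>\<^sup>+\<omega>. Y \<omega> * indicator B (X \<omega>) \<partial>M) = (\<integral>\<^sup>+\<omega>. Y \<omega> * indicator B (- X \<omega>) \<partial>M)"
    if B[measurable]: "B \<in> sets borel" for B
  proof -
    have density: "(\<integral>\<^sup>+\<omega>. Y \<omega> * indicator B (Z \<omega>) \<partial>M)
        = (\<integral>\<^sup>+\<omega>. Y \<omega> \<partial>restr_to_subalg (density M (\<lambda>\<omega>. indicator B (Z \<omega>))) G)"
      if Z[measurable]: "Z \<in> borel_measurable M" for Z :: "'a \<Rightarrow> real"
    proof -
      have "subalgebra (density M (\<lambda>\<omega>. indicator B (Z \<omega>))) G"
        using sub by (simp add: subalgebra_def)
      then have "(\<integral>\<^sup>+\<omega>. Y \<omega> \<partial>restr_to_subalg (density M (\<lambda>\<omega>. indicator B (Z \<omega>))) G)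
          = (\<integral>\<^sup>+\<omega>. Y \<omega> \<partial>density M (\<lambda>\<omega>. indicator B (Z \<omega>)))"
        using Y by (rule nn_integral_subalgebra2)
      then show ?thesis by (simp add: nn_integral_density mult.commute)
    qed
    have "restr_to_subalg (density M (\<lambda>\<omega>. indicator B (X \<omega>))) G
        = restr_to_subalg (density M (\<lambda>\<omega>. indicator B (- X \<omega>))) G"
    proof (rule measure_eqI)
      fix A assume "A \<in> sets (restr_to_subalg (density M (\<lambda>\<omega>. indicator B (X \<omega>))) G)"
      then have A: "A \<in> sets G"
        using sub by (subst (asm) sets_restr_to_subalg) (auto simp: subalgebra_def)
      then have AM[measurable]: "A \<in> sets M" using sub by (auto simp: subalgebra_def)
      have "emeasure (restr_to_subalg (density M (\<lambda>\<omega>. indicator B (Z \<omega>))) G) A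
          = emeasure M (A \<inter> {\<omega> \<in> space M. Z \<omega> \<in> B})"
        if Z[measurable]: "Z \<in> borel_measurable M" for Z :: "'a \<Rightarrow> real"
      proof -
        have "emeasure (restr_to_subalg (density M (\<lambda>\<omega>. indicator B (Z \<omega>))) G) A
            = emeasure (density M (\<lambda>\<omega>. indicator B (Z \<omega>))) A"
          using sub A by (intro emeasure_restr_to_subalg) (auto simp: subalgebra_def)
        also have "\<dots> = (\<integral>\<^sup>+\<omega>. indicator B (Z \<omega>) * indicator A \<omega> \<partial>M)"
          by (rule emeasure_density) auto
        also have "\<dots> = (\<integral>\<^sup>+\<omega>. indicator (A \<inter> {\<omega> \<in> space M. Z \<omega> \<in> B}) \<omega> \<partial>M)"
          by (intro nn_integral_cong) (auto split: split_indicator)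
        also have "\<dots> = emeasure M (A \<inter> {\<omega> \<in> space M. Z \<omega> \<in> B})"
          using AM ev[OF Z B] by (intro nn_integral_indicator) auto
        finally show ?thesis .
      qed
      from this[of X] this[of "\<lambda>\<omega>. - X \<omega>"] real_event[OF A B]
      show "emeasure (restr_to_subalg (density M (\<lambda>\<omega>. indicator B (X \<omega>))) G) A
          = emeasure (restr_to_subalg (density M (\<lambda>\<omega>. indicator B (- X \<omega>))) G) A"
        by (simp add: emeasure_eq_measure)
    qed (use sub in \<open>simp add: subalgebra_def sets_restr_to_subalg\<close>)
    then show ?thesis using density[of X] density[of "\<lambda>\<omega>. - X \<omega>"] by simp
  qed
  have push: "(\<integral>\<^sup>+\<omega>. Y \<omega> * k (Z \<omega>) \<partial>M) = (\<integral>\<^sup>+x. k x \<partial>distr (density M Y) borel Z)"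
    if [measurable]: "Z \<in> borel_measurable M" "k \<in> borel_measurable borel"
    for Z :: "'a \<Rightarrow> real" and k :: "real \<Rightarrow> ennreal"
    by (simp add: nn_integral_distr nn_integral_density)
  have "distr (density M Y) borel X = distr (density M Y) borel (\<lambda>\<omega>. - X \<omega>)"
  proof (rule measure_eqI)
    fix B assume "B \<in> sets (distr (density M Y) borel X)"
    then have B: "B \<in> sets borel" by simp
    show "emeasure (distr (density M Y) borel X) B
        = emeasure (distr (density M Y) borel (\<lambda>\<omega>. - X \<omega>)) B"
      using event[OF B] push[of X "indicator B"] push[of "\<lambda>\<omega>. - X \<omega>" "indicator B"] B by simp
  qed simp
  then show ?thesis using push[of X h] push[of "\<lambda>\<omega>. - X \<omega>" h] by simp
qed

text \<open>Averaging over \<open>X\<close> and \<open>- X\<close> turns the exponential factor into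
  \<open>cosh X * exp (- X\<^sup>2 / 2) \<le> 1\<close>; so no moment of \<open>X\<close> has to exist.\<close>

lemma (in prob_space) exp_supermartingale_step:
  fixes X :: "'a \<Rightarrow> real"
  assumes sub: "subalgebra M G" and X[measurable]: "X \<in> borel_measurable M"
    and sym: "\<And>B. B \<in> sets borel \<Longrightarrow>
      AE \<omega> in M. cond_law M G X B \<omega> = cond_law M G (\<lambda>\<omega>. - X \<omega>) B \<omega>"
    and Y: "Y \<in> borel_measurable G"
  shows "(\<integral>\<^sup>+\<omega>. Y \<omega> * ennreal (exp (X \<omega> - (X \<omega>)\<^sup>2 / 2)) \<partial>M) \<le> (\<integral>\<^sup>+\<omega>. Y \<omega> \<partial>M)"
proof -
  have YM[measurable]: "Y \<in> borel_measurable M" using Y sub by (metis measurable_from_subalg)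
  let ?h = "\<lambda>x::real. ennreal (exp (x - x\<^sup>2 / 2))"
  have le: "?h x + ?h (- x) \<le> 2" for x
  proof -
    have "exp (x - x\<^sup>2 / 2) + exp (- x - x\<^sup>2 / 2) = 2 * cosh x * exp (- (x\<^sup>2 / 2))"
      unfolding diff_conv_add_uminus exp_add by (simp add: cosh_def algebra_simps)
    also have "\<dots> \<le> 2 * exp (x\<^sup>2 / 2) * exp (- (x\<^sup>2 / 2))"
      by (intro mult_right_mono) (simp_all add: cosh_le_exp_half_square)
    also have "\<dots> = 2" by (simp add: exp_minus)
    finally show ?thesis by (simp add: ennreal_plus[symmetric] ennreal_le_iff[of 2, simplified] del: ennreal_plus)
  qed
  have "2 * (\<integral>\<^sup>+\<omega>. Y \<omega> * ?h (X \<omega>) \<partial>M)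
      = (\<integral>\<^sup>+\<omega>. Y \<omega> * ?h (X \<omega>) \<partial>M) + (\<integral>\<^sup>+\<omega>. Y \<omega> * ?h (- X \<omega>) \<partial>M)"
    using nn_integral_symmetric[OF sub X sym Y, of ?h] by (simp add: mult_2)
  also have "\<dots> = (\<integral>\<^sup>+\<omega>. Y \<omega> * (?h (X \<omega>) + ?h (- X \<omega>)) \<partial>M)"
    by (subst nn_integral_add[symmetric]) (auto simp: distrib_left)
  also have "\<dots> \<le> (\<integral>\<^sup>+\<omega>. 2 * Y \<omega> \<partial>M)"
    using le by (intro nn_integral_mono) (metis mult.commute mult_left_mono zero_le)
  also have "\<dots> = 2 * (\<integral>\<^sup>+\<omega>. Y \<omega> \<partial>M)" by (rule nn_integral_cmult) simp
  finally show ?thesis by (subst (asm) ennreal_mult_le_mult_iff) auto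
qed

text \<open>Ville's inequality, with the supermartingale property expressed by integrals over the events of
  the past. On the first crossing at time \<open>n\<close> the mass \<open>Z n\<close> is at least \<open>a\<close>, and the mass that
  has not yet crossed cannot grow; \<open>H n\<close> below is the event of a crossing up to time \<open>n\<close>.\<close>

lemma maximal_inequality:
  fixes Z :: "nat \<Rightarrow> 'a \<Rightarrow> ennreal"
  assumes sub: "\<And>n. subalgebra M (F n)" and mono: "\<And>n. sets (F n) \<subseteq> sets (F (Suc n))"
    and Z: "\<And>n. Z n \<in> borel_measurable (F n)"
    and super: "\<And>n A. A \<in> sets (F n) \<Longrightarrow>
      (\<integral>\<^sup>+\<omega>. Z (Suc n) \<omega> * indicator A \<omega> \<partial>M) \<le> (\<integral>\<^sup>+\<omega>. Z n \<omega> * indicator A \<omega> \<partial>M)"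
  shows "a * emeasure M {\<omega> \<in> space M. \<exists>n. a \<le> Z n \<omega>} \<le> (\<integral>\<^sup>+\<omega>. Z 0 \<omega> \<partial>M)"
proof -
  have ZM[measurable]: "Z n \<in> borel_measurable M" for n
    using Z sub by (metis measurable_from_subalg)
  have sp: "space (F n) = space M" for n using sub by (simp add: subalgebra_def)
  define H where "H n = {\<omega> \<in> space M. \<exists>k\<le>n. a \<le> Z k \<omega>}" for n
  have HM[measurable]: "H n \<in> sets M" for n unfolding H_def by measurable
  have ZF: "Z k \<in> borel_measurable (F n)" if "k \<le> n" for k n
    using that
  proof (induction rule: dec_induct)
    case (step n)
    then show ?case using mono[of n] by (auto simp: measurable_def sp)
  qed (rule Z)
  have HF: "space M - H n \<in> sets (F n)" for n
  proof -
    have "space M - H n = (\<Inter>k\<in>{..n}. {\<omega> \<in> space (F n). Z k \<omega> < a})"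
      by (auto simp: H_def sp not_le dest: leD)
    moreover have "\<And>k. k \<in> {..n} \<Longrightarrow> {\<omega> \<in> space (F n). Z k \<omega> < a} \<in> sets (F n)"
      using ZF[of _ n] by (intro borel_measurable_less) auto
    ultimately show ?thesis by (metis (no_types, lifting) sets.finite_INT finite_atMost atMost_iff empty_iff zero_le)
  qed
  have step: "a * emeasure M (H n) + (\<integral>\<^sup>+\<omega>. Z n \<omega> * indicator (space M - H n) \<omega> \<partial>M)
      \<le> (\<integral>\<^sup>+\<omega>. Z 0 \<omega> \<partial>M)" for n
  proof (induction n)
    case 0
    have "a * emeasure M (H 0) + (\<integral>\<^sup>+\<omega>. Z 0 \<omega> * indicator (space M - H 0) \<omega> \<partial>M)
        = (\<integral>\<^sup>+\<omega>. a * indicator (H 0) \<omega> + Z 0 \<omega> * indicator (space M - H 0) \<omega> \<partial>M)"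
      by (simp add: nn_integral_add nn_integral_cmult_indicator)
    also have "\<dots> \<le> (\<integral>\<^sup>+\<omega>. Z 0 \<omega> \<partial>M)"
      by (intro nn_integral_mono) (auto simp: H_def split: split_indicator)
    finally show ?case .
  next
    case (Suc n)
    let ?D = "H (Suc n) - H n"
    have H: "H (Suc n) = H n \<union> ?D" by (auto simp: H_def le_Suc_eq)
    have "a * emeasure M (H (Suc n)) + (\<integral>\<^sup>+\<omega>. Z (Suc n) \<omega> * indicator (space M - H (Suc n)) \<omega> \<partial>M)
        = a * emeasure M (H n) + (a * emeasure M ?D
          + (\<integral>\<^sup>+\<omega>. Z (Suc n) \<omega> * indicator (space M - H (Suc n)) \<omega> \<partial>M))"
      by (subst H, subst plus_emeasure[symmetric]) (auto simp: distrib_left add.assoc)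
    also have "a * emeasure M ?D + (\<integral>\<^sup>+\<omega>. Z (Suc n) \<omega> * indicator (space M - H (Suc n)) \<omega> \<partial>M)
        = (\<integral>\<^sup>+\<omega>. a * indicator ?D \<omega> + Z (Suc n) \<omega> * indicator (space M - H (Suc n)) \<omega> \<partial>M)"
      by (simp add: nn_integral_add nn_integral_cmult_indicator)
    also have "\<dots> \<le> (\<integral>\<^sup>+\<omega>. Z (Suc n) \<omega> * indicator (space M - H n) \<omega> \<partial>M)"
      by (intro nn_integral_mono) (auto simp: H_def le_Suc_eq split: split_indicator)
    also have "\<dots> \<le> (\<integral>\<^sup>+\<omega>. Z n \<omega> * indicator (space M - H n) \<omega> \<partial>M)"
      by (rule super[OF HF])
    finally show ?case using Suc by (meson add_left_mono order_trans)
  qed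
  have "a * emeasure M (H n) \<le> (\<integral>\<^sup>+\<omega>. Z 0 \<omega> \<partial>M)" for n
    using step[of n] by (meson add_increasing2 order.trans order_refl zero_le)
  moreover have "{\<omega> \<in> space M. \<exists>n. a \<le> Z n \<omega>} = (\<Union>n. H n)" by (auto simp: H_def)
  moreover have "emeasure M (\<Union>n. H n) = (SUP n. emeasure M (H n))"
    by (rule SUP_emeasure_incseq[symmetric]) (auto simp: H_def incseq_def intro: order_trans)
  ultimately show ?thesis by (simp add: SUP_mult_left_ennreal SUP_least)
qed

section \<open>The self-normalized inequality\<close>

theorem mainTheorem7:
  fixes M :: "'a measure" and F :: "nat \<Rightarrow> 'a measure"
    and d :: "nat \<Rightarrow> 'a \<Rightarrow> real ^ 'm" and V :: "real ^ 'm ^ 'm" and c :: real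
  assumes "prob_space M"
    and "\<And>i. subalgebra M (F i)"
    and "filtration (space M) F"
    and "adapted_from_1 F d"
    and "conditionally_symmetric M F d"
    and "c > 0"
    and "positive_definite V"
  shows "measure M {\<omega> \<in> space M. \<exists>n\<ge>1.
           ((\<Sum>i=1..n. d i \<omega>) \<bullet>
              (matrix_inv (V + (\<Sum>i=1..n. outer_square (d i \<omega>))) *v (\<Sum>i=1..n. d i \<omega>)))
           / (ln (det (V + (\<Sum>i=1..n. outer_square (d i \<omega>)))) + 2 * ln (c / sqrt (det V))) \<ge> 1}
         \<le> inverse c"
proof -
  interpret prob_space M by fact
  note sub = assms(2) and V = \<open>positive_definite V\<close>
  have sp: "space (F n) = space M" for n using sub by (simp add: subalgebra_def)
  have monoF: "sets (F i) \<subseteq> sets (F j)" if "i \<le> j" for i j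
    using \<open>filtration (space M) F\<close> that by (simp add: filtration_def)
  have dF: "d i \<in> borel_measurable (F n)" if "1 \<le> i" "i \<le> n" for i n
    using \<open>adapted_from_1 F d\<close> that monoF[of i n]
    by (auto simp: adapted_from_1_def measurable_def sp)
  have dM: "d i \<in> borel_measurable M" if "1 \<le> i" for i
    using dF[of i i] sub that by (metis measurable_from_subalg order_refl)
  define W where "W n \<omega> = V + (\<Sum>i=1..n. outer_square (d i \<omega>))" for n \<omega>
  define S where "S n \<omega> = (\<Sum>i=1..n. d i \<omega>)" for n \<omega>
  have W: "positive_definite (W n \<omega>)" for n \<omega>
    unfolding W_def by (rule positive_definite_add_sum_outer_square[OF V])
  \<comment> \<open>The exponential supermartingale in a fixed direction \<open>x\<close>, already weighted by the (unnormalized)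
    Gaussian density with precision matrix \<open>V\<close>. The product form shows the supermartingale property, the
    closed form below the Gaussian shape in \<open>x\<close>.\<close>
  define E where "E n x \<omega> = exp (- (x \<bullet> (V *v x)) / 2) * (\<Prod>i=1..n. exp (x \<bullet> d i \<omega> - (x \<bullet> d i \<omega>)\<^sup>2 / 2))"
    for n x \<omega>
  have E_eq: "E n x \<omega> = exp (x \<bullet> S n \<omega> - x \<bullet> (W n \<omega> *v x) / 2)" for n x \<omega>
  proof -
    have "x \<bullet> (W n \<omega> *v x) = x \<bullet> (V *v x) + (\<Sum>i=1..n. (x \<bullet> d i \<omega>)\<^sup>2)"
      by (simp add: W_def matrix_vector_mult_add_rdistrib sum_outer_square_mult_vec inner_add_right
          inner_sum_right power2_eq_square inner_commute)
    then show ?thesis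
      by (simp add: E_def S_def inner_sum_right exp_sum[symmetric] exp_add[symmetric]
          sum_subtractf sum_divide_distrib add_divide_distrib)
  qed
  have EF: "(\<lambda>(x, \<omega>). E n x \<omega>) \<in> borel_measurable (borel \<Otimes>\<^sub>M F n)" for n
  proof -
    have [measurable]: "i \<in> {1..n} \<Longrightarrow> d i \<in> borel_measurable (F n)" for i using dF by simp
    show ?thesis unfolding E_def split_beta' by measurable
  qed
  define Z where "Z n \<omega> = (\<integral>\<^sup>+x. ennreal (E n x \<omega>) \<partial>lborel)" for n \<omega>
  have Z_eq: "Z n \<omega> = ennreal (sqrt (det V / det (W n \<omega>))
      * exp (S n \<omega> \<bullet> (matrix_inv (W n \<omega>) *v S n \<omega>) / 2)) * gauss_integral V" for n \<omega>
  proof -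
    have "gauss_integral (W n \<omega>) = ennreal (sqrt (det V / det (W n \<omega>))) * gauss_integral V"
      unfolding W_def by (rule gauss_integral_add_sum_outer_square[OF V])
    then show ?thesis
      using positive_definite_det_pos[OF V] positive_definite_det_pos[OF W[of n \<omega>]]
      by (simp add: Z_def E_eq gauss_integral_tilted[OF W] ennreal_mult ac_simps)
  qed
  have ZF: "Z n \<in> borel_measurable (F n)" for n
  proof -
    have "(\<lambda>(\<omega>, x). ennreal (E n x \<omega>)) \<in> borel_measurable (F n \<Otimes>\<^sub>M lborel)"
      using measurable_compose[OF measurable_pair_swap'[of "F n" borel] EF[of n]]
      by (simp add: split_beta' cong: measurable_cong_sets)
    then show ?thesis unfolding Z_def by (rule lborel.borel_measurable_nn_integral)
  qed
  \<comment> \<open>The mixture inherits the supermartingale property from each direction, by Tonelli.\<close>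
  have super: "(\<integral>\<^sup>+\<omega>. Z (Suc n) \<omega> * indicator A \<omega> \<partial>M) \<le> (\<integral>\<^sup>+\<omega>. Z n \<omega> * indicator A \<omega> \<partial>M)"
    if A: "A \<in> sets (F n)" for n A
  proof -
    interpret P: pair_sigma_finite lborel M ..
    have AM[measurable]: "A \<in> sets M" using A sub by (auto simp: subalgebra_def)
    have EM: "(\<lambda>(x, \<omega>). ennreal (E k x \<omega>)) \<in> borel_measurable (lborel \<Otimes>\<^sub>M M)" for k
    proof -
      have [measurable]: "i \<in> {1..k} \<Longrightarrow> d i \<in> borel_measurable M" for i using dM by simp
      show ?thesis unfolding E_def split_beta' by measurable
    qed
    have swap: "(\<integral>\<^sup>+\<omega>. Z k \<omega> * indicator A \<omega> \<partial>M)
        = (\<integral>\<^sup>+x. (\<integral>\<^sup>+\<omega>. ennreal (E k x \<omega>) * indicator A \<omega> \<partial>M) \<partial>lborel)" for k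
    proof -
      have "(\<lambda>x. ennreal (E k x \<omega>)) \<in> borel_measurable lborel" for \<omega>
        unfolding E_def by measurable
      then have "(\<integral>\<^sup>+\<omega>. Z k \<omega> * indicator A \<omega> \<partial>M)
          = (\<integral>\<^sup>+\<omega>. (\<integral>\<^sup>+x. ennreal (E k x \<omega>) * indicator A \<omega> \<partial>lborel) \<partial>M)"
        unfolding Z_def by (simp add: nn_integral_multc)
      also have "\<dots> = (\<integral>\<^sup>+x. (\<integral>\<^sup>+\<omega>. ennreal (E k x \<omega>) * indicator A \<omega> \<partial>M) \<partial>lborel)"
        using EM[of k] by (intro P.Fubini') (simp add: split_beta')
      finally show ?thesis .
    qed
    show ?thesis unfolding swap
    proof (rule nn_integral_mono)
      fix x :: "real ^ 'm"
      let ?X = "\<lambda>\<omega>. x \<bullet> d (Suc n) \<omega>"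
      have X: "?X \<in> borel_measurable M" using dM[of "Suc n"] by simp
      have Y: "(\<lambda>\<omega>. ennreal (E n x \<omega>) * indicator A \<omega>) \<in> borel_measurable (F n)"
        using measurable_compose[OF measurable_Pair1'[of x borel "F n"] EF[of n]] A by simp
      have "AE \<omega> in M. cond_law M (F n) ?X B \<omega> = cond_law M (F n) (\<lambda>\<omega>. - ?X \<omega>) B \<omega>"
        if "B \<in> sets borel" for B
        using \<open>conditionally_symmetric M F d\<close> that
        unfolding conditionally_symmetric_def by (metis diff_Suc_1 le_add1 plus_1_eq_Suc)
      from exp_supermartingale_step[OF sub X this Y]
      have "(\<integral>\<^sup>+\<omega>. ennreal (E n x \<omega>) * indicator A \<omega> * ennreal (exp (?X \<omega> - (?X \<omega>)\<^sup>2 / 2)) \<partial>M)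
          \<le> (\<integral>\<^sup>+\<omega>. ennreal (E n x \<omega>) * indicator A \<omega> \<partial>M)" by simp
      moreover have "ennreal (E n x \<omega>) * indicator A \<omega> * ennreal (exp (?X \<omega> - (?X \<omega>)\<^sup>2 / 2))
          = ennreal (E (Suc n) x \<omega>) * indicator A \<omega>" for \<omega>
        by (simp add: E_def ennreal_mult prod_nonneg ac_simps)
      ultimately show "(\<integral>\<^sup>+\<omega>. ennreal (E (Suc n) x \<omega>) * indicator A \<omega> \<partial>M)
          \<le> (\<integral>\<^sup>+\<omega>. ennreal (E n x \<omega>) * indicator A \<omega> \<partial>M)" by simp
    qed
  qed
  let ?D = "\<lambda>n \<omega>. ln (det (W n \<omega>)) + 2 * ln (c / sqrt (det V))"
  let ?Q = "\<lambda>n \<omega>. S n \<omega> \<bullet> (matrix_inv (W n \<omega>) *v S n \<omega>)"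
  show ?thesis
  \<comment> \<open>For \<open>c \<le> 1\<close> the denominator may be negative, but then the bound is at least \<open>1\<close>.\<close>
  proof (cases "c \<le> 1")
    case True
    then have "1 \<le> inverse c" using \<open>c > 0\<close> by (simp add: one_le_inverse_iff)
    then show ?thesis using prob_le_1 order_trans by blast
  next
    case False
    define I where "I = enn2real (gauss_integral V)"
    have I: "gauss_integral V = ennreal I" "I > 0"
      using gauss_integral_finite[OF V] gauss_integral_pos[of V]
      by (simp_all add: I_def enn2real_positive_iff)
    let ?B = "{\<omega> \<in> space M. \<exists>n. ennreal (c * I) \<le> Z n \<omega>}"
    have BM: "?B \<in> sets M"
    proof -
      have [measurable]: "Z n \<in> borel_measurable M" for n using ZF sub by (metis measurable_from_subalg)
      show ?thesis by measurable
    qed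
    have "ennreal (c * I) * emeasure M ?B \<le> (\<integral>\<^sup>+\<omega>. Z 0 \<omega> \<partial>M)"
      by (rule maximal_inequality[of M F Z]) (use sub monoF ZF super in auto)
    also have "\<dots> = ennreal I"
      using positive_definite_det_pos[OF V]
      by (simp add: Z_eq W_def S_def I emeasure_space_1)
    finally have "c * I * prob ?B \<le> I"
      using I \<open>c > 0\<close> by (simp add: emeasure_eq_measure ennreal_mult[symmetric])
    then have B: "prob ?B \<le> inverse c" using I \<open>c > 0\<close> by (simp add: field_simps)
    have "ennreal (c * I) \<le> Z n \<omega>"
      if ratio: "?Q n \<omega> / ?D n \<omega> \<ge> 1" for n \<omega>
    proof -
      define v w where "v = det V" and "w = det (W n \<omega>)"
      have vw: "v > 0" "w > 0" using positive_definite_det_pos V W by (auto simp: v_def w_def)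
      \<comment> \<open>A positive denominator is what permits clearing it; here \<open>c > 1\<close> enters.\<close>
      have "v \<le> w"
        unfolding v_def w_def W_def by (rule det_le_det_add_sum_outer_square[OF V])
      then have "ln v \<le> ln w" using vw by simp
      moreover have "ln c > 0" using False by simp
      moreover have "ln (c / sqrt v) = ln c - ln v / 2"
        using vw \<open>c > 0\<close> by (simp add: ln_div ln_sqrt)
      ultimately have "?D n \<omega> > 0" unfolding v_def w_def by linarith
      then have "?D n \<omega> \<le> ?Q n \<omega>" using ratio by (simp add: field_simps)
      then have "ln c \<le> ?Q n \<omega> / 2 + ln (sqrt (v / w))" 
        using vw \<open>c > 0\<close> by (simp add: v_def w_def ln_div ln_sqrt ln_mult field_simps)
      then have "c \<le> sqrt (v / w) * exp (?Q n \<omega> / 2)"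
        using vw \<open>c > 0\<close> by (metis exp_add exp_ln exp_le_cancel_iff mult.commute real_sqrt_gt_0_iff divide_pos_pos)
      then have "ennreal (c * I) \<le> ennreal (sqrt (v / w) * exp (?Q n \<omega> / 2) * I)"
        using I by (intro ennreal_leI) simp
      also have "\<dots> = Z n \<omega>"
        using I vw by (simp add: Z_eq ennreal_mult v_def w_def)
      finally show ?thesis .
    qed
    then have "{\<omega> \<in> space M. \<exists>n\<ge>1. ?Q n \<omega> / ?D n \<omega> \<ge> 1} \<subseteq> ?B" by blast
    then have "prob {\<omega> \<in> space M. \<exists>n\<ge>1. ?Q n \<omega> / ?D n \<omega> \<ge> 1} \<le> prob ?B"
      using BM by (intro finite_measure_mono)
    with B show ?thesis by (simp add: W_def S_def)
  qed
qed

end
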